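(* For each $i\in\{1,\dots,n\}$ let $$\mathcal{A}_i=\operatorname*{arg\,min}_{a_i\in\mathbb{R}_{\geq 0}}\left[\alpha_i\gamma_i\left(\frac{n-1}{n}\right)^2\eta_i(a_i)+f_i(a_i)\right].$$ An action tuple $(a_i^* )_{i=1}^n\in\mathbb{R}_{\geq 0}^n$ is a contract equilibrium (under the compensation contract $\pi_i(y_1,\dots,y_n)=\delta_i-\gamma_i(\hat{x}-y_i)^2$) if and only if $(a_i^* )_{i=1}^n\in\prod_{i=1}^n\mathcal{A}_i$.
   Context: There are $n$ sensors. Sensor $i$ chooses an effort $a_i\in\mathbb{R}_{\geq 0}$ and reports $y_i=x+w_i$, where $x\in\mathbb{R}$ is the unknown quantity being measured and, for each action tuple $(a_1,\dots,a_n)$, $w_i$ is a zero-mean random variable with variance $\mathbb{E}\{w_i^2\}=\eta_i(a_i)$, and $\mathbb{E}\{w_iw_j\}=0$ for $i\neq j$. Standing assumptions: $\eta_i:\mathbb{R}_{\geq 0}\to\mathbb{R}_{\geq 0}$ is twice continuously differentiable and strictly decreasing; $f_i:\mathbb{R}_{\geq 0}\to\mathbb{R}$ (cost of effort) is twice continuously differentiable and strictly increasing. The central planner uses the averaging estimate $\hat{x}=\frac1n(y_1+\dots+y_n)$ and pays sensor $i$ the compensation $p_i=\pi_i(y_1,\dots,y_n)=\delta_i-\gamma_i(\hat{x}-y_i)^2$, with constants $\gamma_i,\delta_i\in\mathbb{R}_{\geq 0}$. With $\alpha_i\in\mathbb{R}_{\geq 0}$ the value-of-compensation, the utility of sensor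 $i$ is $\bar{C}_i(a_i,a_{-i})=\alpha_i\mathbb{E}\{p_i\}-f_i(a_i)$, where $a_{-i}=(a_j)_{j\neq i}$. An action tuple $(a_i^* )_{i=1}^n\in\mathbb{R}_{\geq 0}^n$ is a contract equilibrium if $a_i^*\in\operatorname*{arg\,max}_{a_i\in\mathbb{R}_{\geq 0}}\bar{C}_i(a_i,a_{-i}^* )$ for all $i\in\{1,\dots,n\}$. *)

theory Defs
  imports "HOL-Probability.Probability"
begin

text \<open>Sensors are indexed by \<open>{1..n}\<close>, and an \<open>n\<close>-tuple is an extensional function on
  \<open>{1..n}\<close>, so that products of sets of actions are \<^const>\<open>PiE\<close>.\<close>

text \<open>At the boundary point \<open>0\<close> of the domain, derivatives are one-sided.\<close>

definition C2_on_nonneg :: "(real \<Rightarrow> real) \<Rightarrow> bool" where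
  "C2_on_nonneg g \<longleftrightarrow> (\<exists>g' g''.
     (\<forall>t\<in>{0..}. (g has_real_derivative g' t) (at t within {0..})) \<and>
     (\<forall>t\<in>{0..}. (g' has_real_derivative g'' t) (at t within {0..})) \<and>
     continuous_on {0..} g'')"

definition action_tuples :: "nat \<Rightarrow> (nat \<Rightarrow> real) set" where
  "action_tuples n = (\<Pi>\<^sub>E i\<in>{1..n}. {0..})"

text \<open>\<open>M a\<close> and \<open>w a\<close> are the probability space and the noise under the action tuple \<open>a\<close>.
  Square integrability is explicit because the Bochner integral of a non-integrable function
  is \<open>0\<close>; it implies integrability of the cross products.\<close>

definition sensor_noise ::
  "nat \<Rightarrow> (nat \<Rightarrow> real \<Rightarrow> real) \<Rightarrow> ((nat \<Rightarrow> real) \<Rightarrow> 'w measure) \<Rightarrow>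
    ((nat \<Rightarrow> real) \<Rightarrow> nat \<Rightarrow> 'w \<Rightarrow> real) \<Rightarrow> bool" where
  "sensor_noise n \<eta> M w \<longleftrightarrow> (\<forall>a\<in>action_tuples n.
     prob_space (M a) \<and>
     (\<forall>i\<in>{1..n}.
        integrable (M a) (w a i) \<and> (\<integral>\<omega>. w a i \<omega> \<partial>M a) = 0 \<and>
        integrable (M a) (\<lambda>\<omega>. (w a i \<omega>)\<^sup>2) \<and> (\<integral>\<omega>. (w a i \<omega>)\<^sup>2 \<partial>M a) = \<eta> i (a i)) \<and>
     (\<forall>i\<in>{1..n}. \<forall>j\<in>{1..n}. i \<noteq> j \<longrightarrow> (\<integral>\<omega>. w a i \<omega> * w a j \<omega> \<partial>M a) = 0))"

definition reports ::
  "nat \<Rightarrow> real \<Rightarrow> ((nat \<Rightarrow> real) \<Rightarrow> nat \<Rightarrow> 'w \<Rightarrow> real) \<Rightarrow> (nat \<Rightarrow> real) \<Rightarrow> 'w \<Rightarrow> nat \<Rightarrow> real" where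
  "reports n x w a \<omega> = (\<lambda>i\<in>{1..n}. x + w a i \<omega>)"

definition averaging_estimate :: "nat \<Rightarrow> (nat \<Rightarrow> real) \<Rightarrow> real" where
  "averaging_estimate n y = (1 / real n) * (\<Sum>i=1..n. y i)"

definition compensation ::
  "nat \<Rightarrow> (nat \<Rightarrow> real) \<Rightarrow> (nat \<Rightarrow> real) \<Rightarrow> nat \<Rightarrow> (nat \<Rightarrow> real) \<Rightarrow> real" where
  "compensation n \<gamma> \<delta> i y = \<delta> i - \<gamma> i * (averaging_estimate n y - y i)\<^sup>2"

text \<open>The utility of sensor \<open>i\<close> under a contract \<open>\<pi>\<close>, where \<open>\<pi> i\<close> maps the tuple of all
  reports to the payment of sensor \<open>i\<close>.\<close>

definition utility ::
  "nat \<Rightarrow> ((nat \<Rightarrow> real) \<Rightarrow> 'w measure) \<Rightarrow> ((nat \<Rightarrow> real) \<Rightarrow> nat \<Rightarrow> 'w \<Rightarrow> real) \<Rightarrow> real \<Rightarrow>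
    (nat \<Rightarrow> real) \<Rightarrow> (nat \<Rightarrow> real \<Rightarrow> real) \<Rightarrow> (nat \<Rightarrow> (nat \<Rightarrow> real) \<Rightarrow> real) \<Rightarrow>
    nat \<Rightarrow> (nat \<Rightarrow> real) \<Rightarrow> real" where
  "utility n M w x \<alpha> f \<pi> i a = \<alpha> i * (\<integral>\<omega>. \<pi> i (reports n x w a \<omega>) \<partial>M a) - f i (a i)"

definition contract_equilibrium ::
  "nat \<Rightarrow> (nat \<Rightarrow> (nat \<Rightarrow> real) \<Rightarrow> real) \<Rightarrow> (nat \<Rightarrow> real) \<Rightarrow> bool" where
  "contract_equilibrium n C a \<longleftrightarrow> a \<in> action_tuples n \<and>
     (\<forall>i\<in>{1..n}. is_arg_max (\<lambda>b. C i (a(i := b))) (\<lambda>b. b \<in> {0..}) (a i))"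

end

theory Submission
  imports Defs
begin

text \<open>The deviation of the averaging estimate from report \<open>i\<close> does not involve the measured
  quantity: it is the linear combination of the noises in which noise \<open>i\<close> has coefficient
  \<open>1/n - 1\<close> and every other noise has coefficient \<open>1/n\<close>. As the noises are uncorrelated, the
  variance of this combination is the sum of the variances weighted by the squared coefficients
  (\<open>integral_square_sum_uncorrelated\<close>), and only the term \<open>((n - 1)/n)\<^sup>2 \<eta>\<^sub>i(a\<^sub>i)\<close> depends on the
  action of sensor \<open>i\<close>. Hence, as a function of its own action, the utility of sensor \<open>i\<close> is a
  constant, depending on the actions of the others, minus the objective that defines the \<open>i\<close>-th
  set of minimisers (\<open>utility_fun_upd\<close>). Best responses therefore never depend on what the other
  sensors do, and the equilibrium condition decouples into one minimisation per sensor.\<close>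

text \<open>The bound \<open>\<bar>x * y\<bar> \<le> x\<^sup>2 + y\<^sup>2\<close> gives integrability from that of the squares.\<close>

lemma integrable_mult_of_square_integrable:
  fixes X Y :: "'a \<Rightarrow> real"
  assumes "X \<in> borel_measurable M" "Y \<in> borel_measurable M"
    and "integrable M (\<lambda>\<omega>. (X \<omega>)\<^sup>2)" "integrable M (\<lambda>\<omega>. (Y \<omega>)\<^sup>2)"
  shows "integrable M (\<lambda>\<omega>. X \<omega> * Y \<omega>)"
proof (rule Bochner_Integration.integrable_bound)
  show "integrable M (\<lambda>\<omega>. (X \<omega>)\<^sup>2 + (Y \<omega>)\<^sup>2)"
    using assms by simp
  show "(\<lambda>\<omega>. X \<omega> * Y \<omega>) \<in> borel_measurable M"
    using assms by simp
  have "\<bar>u * v\<bar> \<le> u\<^sup>2 + v\<^sup>2" for u v :: real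
  proof -
    have "2 * (\<bar>u\<bar> * \<bar>v\<bar>) \<le> u\<^sup>2 + v\<^sup>2"
      using sum_squares_bound[of "\<bar>u\<bar>" "\<bar>v\<bar>"] by (simp add: mult.assoc)
    moreover have "0 \<le> \<bar>u\<bar> * \<bar>v\<bar>"
      by simp
    ultimately show ?thesis
      unfolding abs_mult by linarith
  qed
  then show "AE \<omega> in M. norm (X \<omega> * Y \<omega>) \<le> norm ((X \<omega>)\<^sup>2 + (Y \<omega>)\<^sup>2)"
    by simp
qed

text \<open>Bienayme's identity for a linear combination: expanding the square, all mixed terms
  integrate to \<open>0\<close>.\<close>

lemma integral_square_sum_uncorrelated:
  fixes X :: "'i \<Rightarrow> 'a \<Rightarrow> real" and c :: "'i \<Rightarrow> real"
  assumes "finite I"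
    and meas: "\<And>i. i \<in> I \<Longrightarrow> X i \<in> borel_measurable M"
    and sq: "\<And>i. i \<in> I \<Longrightarrow> integrable M (\<lambda>\<omega>. (X i \<omega>)\<^sup>2)"
    and uncorr: "\<And>i j. i \<in> I \<Longrightarrow> j \<in> I \<Longrightarrow> i \<noteq> j \<Longrightarrow> (\<integral>\<omega>. X i \<omega> * X j \<omega> \<partial>M) = 0"
  shows "integrable M (\<lambda>\<omega>. (\<Sum>i\<in>I. c i * X i \<omega>)\<^sup>2)"
    and "(\<integral>\<omega>. (\<Sum>i\<in>I. c i * X i \<omega>)\<^sup>2 \<partial>M) = (\<Sum>i\<in>I. (c i)\<^sup>2 * (\<integral>\<omega>. (X i \<omega>)\<^sup>2 \<partial>M))"
proof -
  have expand: "(\<lambda>\<omega>. (\<Sum>i\<in>I. c i * X i \<omega>)\<^sup>2) =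
      (\<lambda>\<omega>. \<Sum>i\<in>I. \<Sum>j\<in>I. (c i * c j) * (X i \<omega> * X j \<omega>))"
    by (simp add: power2_eq_square sum_product mult_ac)
  have int: "integrable M (\<lambda>\<omega>. X i \<omega> * X j \<omega>)" if "i \<in> I" "j \<in> I" for i j
    using that by (intro integrable_mult_of_square_integrable meas sq)
  show "integrable M (\<lambda>\<omega>. (\<Sum>i\<in>I. c i * X i \<omega>)\<^sup>2)"
    unfolding expand by (intro Bochner_Integration.integrable_sum integrable_mult_right int)
  have "(\<integral>\<omega>. (\<Sum>i\<in>I. c i * X i \<omega>)\<^sup>2 \<partial>M) =
      (\<Sum>i\<in>I. \<Sum>j\<in>I. (c i * c j) * (\<integral>\<omega>. X i \<omega> * X j \<omega> \<partial>M))"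
    unfolding expand by (simp add: int)
  also have "\<dots> = (\<Sum>i\<in>I. \<Sum>j\<in>I. if j = i then (c i)\<^sup>2 * (\<integral>\<omega>. (X i \<omega>)\<^sup>2 \<partial>M) else 0)"
    by (intro sum.cong refl) (auto simp: uncorr power2_eq_square)
  also have "\<dots> = (\<Sum>i\<in>I. (c i)\<^sup>2 * (\<integral>\<omega>. (X i \<omega>)\<^sup>2 \<partial>M))"
    using \<open>finite I\<close> by simp
  finally show "(\<integral>\<omega>. (\<Sum>i\<in>I. c i * X i \<omega>)\<^sup>2 \<partial>M) = \<dots>" .
qed

text \<open>The coefficients of the noises sum to \<open>0\<close>, so the measured quantity \<open>x\<close> cancels.\<close>

lemma averaging_estimate_minus_report:
  assumes i: "i \<in> {1..n}"
  shows "averaging_estimate n (reports n x w a \<omega>) - reports n x w a \<omega> i =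
    (\<Sum>j=1..n. (1 / real n - of_bool (j = i)) * w a j \<omega>)"
proof -
  have n: "real n \<noteq> 0"
    using i by auto
  have "(\<Sum>j=1..n. (1 / real n - of_bool (j = i)) * w a j \<omega>) =
      (\<Sum>j=1..n. 1 / real n * w a j \<omega>) - (\<Sum>j=1..n. if j = i then w a i \<omega> else 0)"
    unfolding sum_subtractf[symmetric] by (intro sum.cong refl) (auto simp: algebra_simps)
  also have "\<dots> = 1 / real n * (\<Sum>j=1..n. w a j \<omega>) - w a i \<omega>"
    using i by (simp add: sum_distrib_left)
  also have "\<dots> = averaging_estimate n (reports n x w a \<omega>) - reports n x w a \<omega> i"
    using i n by (simp add: averaging_estimate_def reports_def sum.distrib distrib_left)
  finally show ?thesis ..
qed

lemma integral_compensation: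
  assumes noise: "sensor_noise n \<eta> M w" and a: "a \<in> action_tuples n" and i: "i \<in> {1..n}"
  shows "(\<integral>\<omega>. compensation n \<gamma> \<delta> i (reports n x w a \<omega>) \<partial>M a) =
    \<delta> i - \<gamma> i * (((real n - 1) / real n)\<^sup>2 * \<eta> i (a i) +
      (\<Sum>j\<in>{1..n} - {i}. \<eta> j (a j) / (real n)\<^sup>2))"
proof -
  let ?c = "\<lambda>j. 1 / real n - of_bool (j = i)"
  let ?D = "\<lambda>\<omega>. \<Sum>j=1..n. ?c j * w a j \<omega>"
  interpret prob_space "M a"
    using noise a by (auto simp: sensor_noise_def)
  have meas: "w a j \<in> borel_measurable (M a)" and sq: "integrable (M a) (\<lambda>\<omega>. (w a j \<omega>)\<^sup>2)"
    and var: "(\<integral>\<omega>. (w a j \<omega>)\<^sup>2 \<partial>M a) = \<eta> j (a j)" if "j \<in> {1..n}" for j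
    using noise a that by (auto simp: sensor_noise_def intro: borel_measurable_integrable)
  have uncorr: "(\<integral>\<omega>. w a j \<omega> * w a k \<omega> \<partial>M a) = 0"
    if "j \<in> {1..n}" "k \<in> {1..n}" "j \<noteq> k" for j k
    using noise a that by (simp add: sensor_noise_def)
  have int: "integrable (M a) (\<lambda>\<omega>. (?D \<omega>)\<^sup>2)"
    by (rule integral_square_sum_uncorrelated(1)) (auto intro: meas sq uncorr)
  have "(\<integral>\<omega>. (?D \<omega>)\<^sup>2 \<partial>M a) = (\<Sum>j=1..n. (?c j)\<^sup>2 * (\<integral>\<omega>. (w a j \<omega>)\<^sup>2 \<partial>M a))"
    by (rule integral_square_sum_uncorrelated(2)) (auto intro: meas sq uncorr)
  also have "\<dots> = (\<Sum>j=1..n. (?c j)\<^sup>2 * \<eta> j (a j))"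
    by (intro sum.cong refl) (simp add: var)
  also have "\<dots> = (?c i)\<^sup>2 * \<eta> i (a i) + (\<Sum>j\<in>{1..n} - {i}. (?c j)\<^sup>2 * \<eta> j (a j))"
    using i by (simp add: sum.remove)
  also have "(?c i)\<^sup>2 = ((real n - 1) / real n)\<^sup>2"
    using i by (simp add: diff_divide_distrib power2_commute)
  also have "(\<Sum>j\<in>{1..n} - {i}. (?c j)\<^sup>2 * \<eta> j (a j)) =
      (\<Sum>j\<in>{1..n} - {i}. \<eta> j (a j) / (real n)\<^sup>2)"
    by (intro sum.cong refl) (simp add: power_divide)
  finally have "(\<integral>\<omega>. (?D \<omega>)\<^sup>2 \<partial>M a) = ((real n - 1) / real n)\<^sup>2 * \<eta> i (a i) +
      (\<Sum>j\<in>{1..n} - {i}. \<eta> j (a j) / (real n)\<^sup>2)" .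
  then show ?thesis
    unfolding compensation_def averaging_estimate_minus_report[OF i]
    using int by (simp add: prob_space)
qed

text \<open>A unilateral deviation of sensor \<open>i\<close> changes neither the fixed payment nor the variances
  of the other noises; these make up the part that is constant in \<open>b\<close>.\<close>

lemma utility_fun_upd:
  assumes noise: "sensor_noise n \<eta> M w" and a: "a \<in> action_tuples n" and i: "i \<in> {1..n}"
    and "b \<ge> 0"
  shows "utility n M w x \<alpha> f (compensation n \<gamma> \<delta>) i (a(i := b)) =
    \<alpha> i * (\<delta> i - \<gamma> i * (\<Sum>j\<in>{1..n} - {i}. \<eta> j (a j) / (real n)\<^sup>2)) -
    (\<alpha> i * \<gamma> i * ((real n - 1) / real n)\<^sup>2 * \<eta> i b + f i b)"
proof -
  have upd: "a(i := b) \<in> action_tuples n"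
    using a i \<open>b \<ge> 0\<close> by (auto simp: action_tuples_def PiE_iff extensional_def)
  have others: "(\<Sum>j\<in>{1..n} - {i}. \<eta> j ((a(i := b)) j) / (real n)\<^sup>2) =
      (\<Sum>j\<in>{1..n} - {i}. \<eta> j (a j) / (real n)\<^sup>2)"
    by (intro sum.cong refl) simp
  show ?thesis
    unfolding utility_def integral_compensation[OF noise upd i] others
    by (simp only: fun_upd_same) (simp add: algebra_simps)
qed

theorem proposition1:
  fixes n :: nat and x :: real
    and M :: "(nat \<Rightarrow> real) \<Rightarrow> 'w measure"
    and w :: "(nat \<Rightarrow> real) \<Rightarrow> nat \<Rightarrow> 'w \<Rightarrow> real"
    and \<eta> f :: "nat \<Rightarrow> real \<Rightarrow> real"
    and \<alpha> \<gamma> \<delta> a :: "nat \<Rightarrow> real"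
  assumes "n \<ge> 1"
    and "\<And>i. i \<in> {1..n} \<Longrightarrow> \<eta> i \<in> {0..} \<rightarrow> {0..}"
    and "\<And>i. i \<in> {1..n} \<Longrightarrow> C2_on_nonneg (\<eta> i)"
    and "\<And>i. i \<in> {1..n} \<Longrightarrow> strict_antimono_on {0..} (\<eta> i)"
    and "\<And>i. i \<in> {1..n} \<Longrightarrow> C2_on_nonneg (f i)"
    and "\<And>i. i \<in> {1..n} \<Longrightarrow> strict_mono_on {0..} (f i)"
    and "\<And>i. i \<in> {1..n} \<Longrightarrow> \<alpha> i \<ge> 0"
    and "\<And>i. i \<in> {1..n} \<Longrightarrow> \<gamma> i \<ge> 0"
    and "\<And>i. i \<in> {1..n} \<Longrightarrow> \<delta> i \<ge> 0"
    and "sensor_noise n \<eta> M w"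
    and "a \<in> action_tuples n"
  shows "contract_equilibrium n (utility n M w x \<alpha> f (compensation n \<gamma> \<delta>)) a \<longleftrightarrow>
    a \<in> (\<Pi>\<^sub>E i\<in>{1..n}. {b. is_arg_min
      (\<lambda>b. \<alpha> i * \<gamma> i * ((real n - 1) / real n)\<^sup>2 * \<eta> i b + f i b) (\<lambda>b. b \<in> {0..}) b})"
proof -
  have best_response: "is_arg_max (\<lambda>b. utility n M w x \<alpha> f (compensation n \<gamma> \<delta>) i (a(i := b)))
        (\<lambda>b. b \<in> {0..}) (a i) \<longleftrightarrow>
      is_arg_min (\<lambda>b. \<alpha> i * \<gamma> i * ((real n - 1) / real n)\<^sup>2 * \<eta> i b + f i b)
        (\<lambda>b. b \<in> {0..}) (a i)" if "i \<in> {1..n}" for i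
    using utility_fun_upd[OF \<open>sensor_noise n \<eta> M w\<close> \<open>a \<in> action_tuples n\<close> that]
    by (auto simp: is_arg_max_def is_arg_min_def simp del: fun_upd_apply fun_upd_triv)
  have "a \<in> extensional {1..n}"
    using \<open>a \<in> action_tuples n\<close> by (simp add: action_tuples_def PiE_iff)
  then show ?thesis
    using \<open>a \<in> action_tuples n\<close> best_response by (auto simp: contract_equilibrium_def PiE_iff)
qed

end
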